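(* Let $X$ be a convex subset of a (real or complex) normed space. Then $$\Sigma(A,B,t)=\overline{(1-t)A+tB}, \qquad A,B\in CB(X),\ t\in[0,1],$$ defines a reversible consistent convex geodesic bicombing on $(CB(X),d_H)$.
   Context: Bicombings. A geodesic bicombing on a metric space $(Y,\rho)$ is a function $\sigma:Y\times Y\times[0,1]\to Y$ such that for all $x,y\in Y$ and $s,t\in[0,1]$: $\sigma(x,y,0)=x$, $\sigma(x,y,1)=y$, and $\rho(\sigma(x,y,s),\sigma(x,y,t))=|t-s|\rho(x,y)$. It is convex if for all $a,b,c,d\in Y$ the map $t\mapsto\rho(\sigma(a,b,t),\sigma(c,d,t))$ is convex on $[0,1]$. It is consistent if $\sigma(\sigma(x,y,r),\sigma(x,y,s),t)=\sigma(x,y,(1-t)r+ts)$ for all $x,y\in Y$ and $r,s,t\in[0,1]$ with $r<s$. It is reversible if $\sigma(x,y,t)=\sigma(y,x,1-t)$ for all $x,y\in Y$, $t\in[0,1]$. $X$ carries the metric $d$ induced by the norm, and is equipped with the bicombing $(x,y,t)\mapsto(1-t)x+ty$, so that convex subsets of $X$ are convex in the usual vector space sense. $(1-t)A+tB=\{(1-t)a+tb: a\in A, b\in B\}$, and the bar denotes closure in the metric space $X$. Hyperspace. $CB(X)$ is the set of nonempty, closed (in $X$), bounded, convex subsets of $X$, equipped with the Hausdorff metric $d_H(A,B)=\inf\{\varepsilon>0: A\subseteq N_\varepsilon(B)\text{ and }B\subseteq N_\varepsilon(A)\}$, where $N_\varepsilon(A)=\{x\in X: d(x,A)\le\varepsilon\}$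 and $d(x,A)=\inf_{a\in A}d(x,a)$. *)

theory Defs
  imports "HOL-Analysis.Analysis"
begin

text \<open>The bicombing is a total HOL function; only its values on \<open>Y \<times> Y \<times> {0..1}\<close> matter.\<close>

locale geodesic_bicombing = Metric_space Y \<rho>
  for Y :: "'a set" and \<rho> :: "'a \<Rightarrow> 'a \<Rightarrow> real" +
  fixes \<sigma> :: "'a \<Rightarrow> 'a \<Rightarrow> real \<Rightarrow> 'a"
  assumes in_space: "\<lbrakk>x \<in> Y; y \<in> Y; t \<in> {0..1}\<rbrakk> \<Longrightarrow> \<sigma> x y t \<in> Y"
    and start: "\<lbrakk>x \<in> Y; y \<in> Y\<rbrakk> \<Longrightarrow> \<sigma> x y 0 = x"
    and finish: "\<lbrakk>x \<in> Y; y \<in> Y\<rbrakk> \<Longrightarrow> \<sigma> x y 1 = y"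
    and geodesic: "\<lbrakk>x \<in> Y; y \<in> Y; s \<in> {0..1}; t \<in> {0..1}\<rbrakk>
      \<Longrightarrow> \<rho> (\<sigma> x y s) (\<sigma> x y t) = \<bar>t - s\<bar> * \<rho> x y"

definition convex_bicombing ::
    "'a set \<Rightarrow> ('a \<Rightarrow> 'a \<Rightarrow> real) \<Rightarrow> ('a \<Rightarrow> 'a \<Rightarrow> real \<Rightarrow> 'a) \<Rightarrow> bool" where
  "convex_bicombing Y \<rho> \<sigma> \<longleftrightarrow>
    (\<forall>a\<in>Y. \<forall>b\<in>Y. \<forall>c\<in>Y. \<forall>d\<in>Y. convex_on {0..1} (\<lambda>t. \<rho> (\<sigma> a b t) (\<sigma> c d t)))"

definition consistent_bicombing :: "'a set \<Rightarrow> ('a \<Rightarrow> 'a \<Rightarrow> real \<Rightarrow> 'a) \<Rightarrow> bool" where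
  "consistent_bicombing Y \<sigma> \<longleftrightarrow>
    (\<forall>x\<in>Y. \<forall>y\<in>Y. \<forall>r\<in>{0..1}. \<forall>s\<in>{0..1}. \<forall>t\<in>{0..1}. r < s \<longrightarrow>
      \<sigma> (\<sigma> x y r) (\<sigma> x y s) t = \<sigma> x y ((1 - t) * r + t * s))"

definition reversible_bicombing :: "'a set \<Rightarrow> ('a \<Rightarrow> 'a \<Rightarrow> real \<Rightarrow> 'a) \<Rightarrow> bool" where
  "reversible_bicombing Y \<sigma> \<longleftrightarrow>
    (\<forall>x\<in>Y. \<forall>y\<in>Y. \<forall>t\<in>{0..1}. \<sigma> x y t = \<sigma> y x (1 - t))"

text \<open>Only real scalars enter below, so a complex normed space is covered through its underlying
  real normed space. Closedness and closure are relative to the subspace \<open>X\<close>, which need not be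
  closed in the ambient normed space.\<close>

definition CB :: "'a::real_normed_vector set \<Rightarrow> 'a set set" where
  "CB X = {A. A \<subseteq> X \<and> A \<noteq> {} \<and> closedin (top_of_set X) A \<and> bounded A \<and> convex A}"

definition nbhd :: "'a::metric_space set \<Rightarrow> real \<Rightarrow> 'a set \<Rightarrow> 'a set" where
  "nbhd X \<epsilon> A = {x \<in> X. infdist x A \<le> \<epsilon>}"

text \<open>The value 0 off \<open>CB X\<close> is needed because \<^locale>\<open>Metric_space\<close> requires nonnegativity and
  symmetry on the whole type, while an infimum over the empty set is an unspecified real number.\<close>

definition hausdorff_dist :: "'a::real_normed_vector set \<Rightarrow> 'a set \<Rightarrow> 'a set \<Rightarrow> real" where
  "hausdorff_dist X A B =
    (if A \<in> CB X \<and> B \<in> CB X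
     then Inf {\<epsilon>. \<epsilon> > 0 \<and> A \<subseteq> nbhd X \<epsilon> B \<and> B \<subseteq> nbhd X \<epsilon> A}
     else 0)"

definition hyper_bicombing ::
    "'a::real_normed_vector set \<Rightarrow> 'a set \<Rightarrow> 'a set \<Rightarrow> real \<Rightarrow> 'a set" where
  "hyper_bicombing X A B t =
    (top_of_set X) closure_of {(1 - t) *\<^sub>R a + t *\<^sub>R b | a b. a \<in> A \<and> b \<in> B}"

end

theory Submission
  imports Defs
begin

text \<open>
  Apart from reversibility and the values at the endpoints, which are immediate, everything
  follows from three facts about the combination \<open>(1 - t)A + tB\<close>: it is idempotent (\<open>(1 - t)A + tA = A\<close> for convex \<open>A\<close>), it satisfies the
  consistency identity exactly because convex sets satisfy \<open>pA + qA = (p + q)A\<close> for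
  \<open>p, q \<ge> 0\<close>, and it is jointly contractive:
  the distance from \<open>(1 - t)A + tB\<close> to \<open>(1 - t)C + tD\<close> is at most
  \<open>(1 - t) d(A,C) + t d(B,D)\<close>, since the two summands can be moved separately.  None of these is disturbed by closures: the Hausdorff distance does not see
  them, and the closure of a combination of closures is the closure of the combination
  by continuity of the vector space operations.

  In any metric space, the endpoint conditions, idempotence, consistency and the contraction inequality already
  force a convex geodesic bicombing (lemma \<open>geodesic_and_convex_if_contractive\<close>).
  Comparing with constant curves bounds the distance along a curve from above, the triangle
  inequality turns the upper bounds into equalities, and consistency transports the
  inequality from the endpoints to arbitrary subintervals, which is convexity.

  The infimum in the Hausdorff distance is used only through its sublevel sets: a bound by \<open>e\<close>
  means that each set is approximately within \<open>e\<close> of the other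
  (lemma \<open>hausdorff_dist_le_iff\<close>).
\<close>

section \<open>Contractive idempotent bicombings\<close>

text \<open>The abstract form of the argument; linearity enters only through the three
  assumptions on idempotence, consistency and contraction.\<close>

lemma geodesic_and_convex_if_contractive:
  assumes "Metric_space Y \<rho>"
    and in_space: "\<And>x y t. \<lbrakk>x \<in> Y; y \<in> Y; t \<in> {0..1}\<rbrakk> \<Longrightarrow> \<sigma> x y t \<in> Y"
    and start: "\<And>x y. \<lbrakk>x \<in> Y; y \<in> Y\<rbrakk> \<Longrightarrow> \<sigma> x y 0 = x"
    and finish: "\<And>x y. \<lbrakk>x \<in> Y; y \<in> Y\<rbrakk> \<Longrightarrow> \<sigma> x y 1 = y"
    and idem: "\<And>x t. \<lbrakk>x \<in> Y; t \<in> {0..1}\<rbrakk> \<Longrightarrow> \<sigma> x x t = x"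
    and consistent: "consistent_bicombing Y \<sigma>"
    and contractive: "\<And>a b c d t. \<lbrakk>a \<in> Y; b \<in> Y; c \<in> Y; d \<in> Y; t \<in> {0..1}\<rbrakk>
      \<Longrightarrow> \<rho> (\<sigma> a b t) (\<sigma> c d t) \<le> (1 - t) * \<rho> a c + t * \<rho> b d"
  shows "geodesic_bicombing Y \<rho> \<sigma>" and "convex_bicombing Y \<rho> \<sigma>"
proof -
  interpret Metric_space Y \<rho> by fact
  have reparam: "\<sigma> (\<sigma> x y r) (\<sigma> x y s) t = \<sigma> x y ((1 - t) * r + t * s)"
    if "x \<in> Y" "y \<in> Y" "r \<in> {0..1}" "s \<in> {0..1}" "t \<in> {0..1}" "r < s" for x y r s t
    using consistent that unfolding consistent_bicombing_def by blast
  have from_start: "\<rho> x (\<sigma> x y t) \<le> t * \<rho> x y" if "x \<in> Y" "y \<in> Y" "t \<in> {0..1}" for x y t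
    using contractive[of x x x y t] that by (simp add: idem)
  have to_finish: "\<rho> (\<sigma> x y t) y \<le> (1 - t) * \<rho> x y" if "x \<in> Y" "y \<in> Y" "t \<in> {0..1}" for x y t
    using contractive[of x y y y t] that by (simp add: idem)
  have upper: "\<rho> (\<sigma> x y s) (\<sigma> x y t) \<le> (t - s) * \<rho> x y"
    if xy: "x \<in> Y" "y \<in> Y" and st: "0 \<le> s" "s < t" "t \<le> 1" for x y s t
  proof -
    \<comment> \<open>The point at time \<open>s\<close> lies at parameter \<open>s / t\<close> on the curve from \<open>x\<close> to the point at
      time \<open>t\<close>.\<close>
    let ?z = "\<sigma> x y t"
    have z: "?z \<in> Y" using xy st by (intro in_space) auto
    have u: "s / t \<in> {0..1}" using st by (auto simp: field_simps)
    have "\<sigma> x ?z (s / t) = \<sigma> x y s"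
      using reparam[of x y 0 t "s / t"] xy st u by (simp add: start)
    then have "\<rho> (\<sigma> x y s) ?z \<le> (1 - s / t) * \<rho> x ?z"
      using to_finish[OF xy(1) z u] by simp
    also have "\<dots> \<le> (1 - s / t) * (t * \<rho> x y)"
      using from_start[of x y t] xy st u by (intro mult_left_mono) auto
    also have "\<dots> = (t - s) * \<rho> x y"
      using st by (simp add: field_simps)
    finally show ?thesis .
  qed
  have ordered: "\<rho> (\<sigma> x y s) (\<sigma> x y t) = (t - s) * \<rho> x y"
    if xy: "x \<in> Y" "y \<in> Y" and st: "0 \<le> s" "s < t" "t \<le> 1" for x y s t
  proof (rule antisym[OF upper[OF that]])
    have mem: "\<sigma> x y s \<in> Y" "\<sigma> x y t \<in> Y"
      using xy st by (auto intro: in_space)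
    have "\<rho> x y \<le> \<rho> x (\<sigma> x y s) + \<rho> (\<sigma> x y s) (\<sigma> x y t) + \<rho> (\<sigma> x y t) y"
      using triangle[of x "\<sigma> x y s" y] triangle[of "\<sigma> x y s" "\<sigma> x y t" y] xy mem by linarith
    also have "\<dots> \<le> s * \<rho> x y + \<rho> (\<sigma> x y s) (\<sigma> x y t) + (1 - t) * \<rho> x y"
      using from_start[of x y s] to_finish[of x y t] xy st by simp
    finally show "(t - s) * \<rho> x y \<le> \<rho> (\<sigma> x y s) (\<sigma> x y t)"
      by (simp add: algebra_simps)
  qed
  show "geodesic_bicombing Y \<rho> \<sigma>"
  proof
    fix x y s t
    assume *: "x \<in> Y" "y \<in> Y" "s \<in> {0..1::real}" "t \<in> {0..1::real}"
    consider "s < t" | "t < s" | "s = t" by linarith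
    then show "\<rho> (\<sigma> x y s) (\<sigma> x y t) = \<bar>t - s\<bar> * \<rho> x y"
    proof cases
      case 1
      then show ?thesis using ordered[of x y s t] * by simp
    next
      case 2
      then show ?thesis using ordered[of x y t s] * by (simp add: commute)
    next
      case 3
      then show ?thesis using * in_space[of x y t] by simp
    qed
  qed (auto intro: in_space start finish)
  show "convex_bicombing Y \<rho> \<sigma>"
    unfolding convex_bicombing_def
  proof (intro ballI convex_on_linorderI)
    fix a b c d t r s
    assume *: "a \<in> Y" "b \<in> Y" "c \<in> Y" "d \<in> Y"
      "0 < t" "t < (1::real)" "r \<in> {0..1::real}" "s \<in> {0..1::real}" "r < s"
    have "\<rho> (\<sigma> (\<sigma> a b r) (\<sigma> a b s) t) (\<sigma> (\<sigma> c d r) (\<sigma> c d s) t)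
        \<le> (1 - t) * \<rho> (\<sigma> a b r) (\<sigma> c d r) + t * \<rho> (\<sigma> a b s) (\<sigma> c d s)"
      using * by (intro contractive in_space) auto
    then show "\<rho> (\<sigma> a b ((1 - t) *\<^sub>R r + t *\<^sub>R s)) (\<sigma> c d ((1 - t) *\<^sub>R r + t *\<^sub>R s))
        \<le> (1 - t) * \<rho> (\<sigma> a b r) (\<sigma> c d r) + t * \<rho> (\<sigma> a b s) (\<sigma> c d s)"
      using * by (simp add: reparam)
  qed auto
qed

section \<open>Sublevel sets of the Hausdorff distance\<close>

text \<open>One half of the Hausdorff bound.  The slack \<open>\<eta>\<close> replaces an infimum that need not be
  attained.\<close>

definition approx_within :: "real \<Rightarrow> 'a::metric_space set \<Rightarrow> 'a set \<Rightarrow> bool" where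
  "approx_within e A B \<longleftrightarrow> (\<forall>a\<in>A. \<forall>\<eta>>e. \<exists>b\<in>B. dist a b \<le> \<eta>)"

lemma approx_within_iff_infdist:
  assumes "B \<noteq> {}"
  shows "approx_within e A B \<longleftrightarrow> (\<forall>a\<in>A. infdist a B \<le> e)"
proof safe
  fix a assume "approx_within e A B" "a \<in> A"
  then have "infdist a B \<le> \<eta>" if "e < \<eta>" for \<eta>
    using that infdist_le2 unfolding approx_within_def by blast
  then show "infdist a B \<le> e" by (rule dense_ge)
next
  assume le: "\<forall>a\<in>A. infdist a B \<le> e"
  show "approx_within e A B"
    unfolding approx_within_def
  proof (intro ballI allI impI)
    fix a \<eta> assume "a \<in> A" "e < \<eta>"
    then have "infdist a B < \<eta>" using le by force
    then have "\<exists>b\<in>B. dist a b < \<eta>"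
      using assms by (simp add: infdist_notempty cINF_less_iff)
    then show "\<exists>b\<in>B. dist a b \<le> \<eta>" by (meson less_imp_le)
  qed
qed

lemma approx_within_trans:
  assumes "approx_within e A B" "approx_within f B C"
  shows "approx_within (e + f) A C"
  unfolding approx_within_def
proof (intro ballI allI impI)
  fix a \<eta> assume a: "a \<in> A" and \<eta>: "e + f < \<eta>"
  define \<delta> where "\<delta> = (\<eta> - (e + f)) / 2"
  have \<delta>: "\<delta> > 0" "\<eta> = (e + \<delta>) + (f + \<delta>)"
    using \<eta> by (auto simp: \<delta>_def field_simps)
  obtain b where b: "b \<in> B" "dist a b \<le> e + \<delta>"
    using assms(1) a \<delta>(1) unfolding approx_within_def by (metis less_add_same_cancel1)
  obtain c where c: "c \<in> C" "dist b c \<le> f + \<delta>"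
    using assms(2) b(1) \<delta>(1) unfolding approx_within_def by (metis less_add_same_cancel1)
  have "dist a c \<le> \<eta>"
    using b(2) c(2) dist_triangle[of a c b] \<delta>(2) by linarith
  with c(1) show "\<exists>c\<in>C. dist a c \<le> \<eta>" by blast
qed

text \<open>Passing to closures costs nothing, because the slack absorbs the approximation.\<close>

lemma approx_within_closure:
  assumes "approx_within e A B" "A' \<subseteq> closure A" "B \<subseteq> B'"
  shows "approx_within e A' B'"
proof -
  have "approx_within 0 A' A"
    using assms(2) unfolding approx_within_def closure_approachable subset_iff
    by (metis dist_commute less_imp_le)
  then have "approx_within e A' B"
    using approx_within_trans[OF _ assms(1)] by force
  then show ?thesis
    using assms(3) unfolding approx_within_def by blast
qed

lemma approx_within_exists:
  assumes "bounded A" "bounded B" "B \<noteq> {}"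
  obtains e where "e > 0" "approx_within e A B"
proof -
  obtain c where c: "\<And>a b. \<lbrakk>a \<in> A \<union> B; b \<in> A \<union> B\<rbrakk> \<Longrightarrow> dist a b \<le> c"
    using bounded_two_points[of "A \<union> B"] assms(1,2) by auto
  have "approx_within (max c 1) A B"
    unfolding approx_within_def
  proof (intro ballI allI impI)
    fix a \<eta> assume "a \<in> A" "max c 1 < \<eta>"
    moreover obtain b where "b \<in> B" using assms(3) by blast
    ultimately show "\<exists>b\<in>B. dist a b \<le> \<eta>" using c[of a b] by force
  qed
  with that[of "max c 1"] show ?thesis by simp
qed

lemma approx_within_mono: "approx_within e A B \<Longrightarrow> e \<le> f \<Longrightarrow> approx_within f A B"
  unfolding approx_within_def by (meson le_less_trans)

lemma approx_within_nonneg: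
  assumes "approx_within e A B" "A \<noteq> {}"
  shows "0 \<le> e"
proof (rule dense_ge)
  fix \<eta> assume "e < \<eta>"
  then show "0 \<le> \<eta>"
    using assms unfolding approx_within_def by (metis all_not_in_conv order_trans zero_le_dist)
qed

lemma CB_D:
  assumes "A \<in> CB X"
  shows "A \<subseteq> X" "A \<noteq> {}" "closedin (top_of_set X) A" "bounded A" "convex A"
  using assms by (auto simp: CB_def)

lemma Int_closure_CB: "A \<in> CB X \<Longrightarrow> X \<inter> closure A = A"
  using closure_of_closedin[OF CB_D(3)[of A X]] CB_D(1)[of A X]
  by (simp add: closure_of_subtopology Int_absorb1)

lemma subset_nbhd_iff_approx_within:
  "A \<subseteq> X \<Longrightarrow> B \<noteq> {} \<Longrightarrow> A \<subseteq> nbhd X e B \<longleftrightarrow> approx_within e A B"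
  by (auto simp: approx_within_iff_infdist nbhd_def)

text \<open>Boundedness of both sets makes the infimum range over a nonempty set of levels, and the
  levels are upward closed; the slack in \<open>approx_within\<close> then lets the bound pass to the
  infimum itself.\<close>

lemma hausdorff_dist_le_iff:
  assumes A: "A \<in> CB X" and B: "B \<in> CB X"
  shows "hausdorff_dist X A B \<le> e \<longleftrightarrow> approx_within e A B \<and> approx_within e B A"
proof -
  define S where "S = {\<epsilon>. \<epsilon> > 0 \<and> approx_within \<epsilon> A B \<and> approx_within \<epsilon> B A}"
  have dist_eq: "hausdorff_dist X A B = Inf S"
    using A B by (simp add: hausdorff_dist_def S_def subset_nbhd_iff_approx_within CB_D)
  obtain f g where "f > 0" "approx_within f A B" "g > 0" "approx_within g B A"
    using approx_within_exists[of A B] approx_within_exists[of B A] CB_D[OF A] CB_D[OF B] by metis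
  then have "max f g \<in> S"
    unfolding S_def by (auto intro: approx_within_mono)
  then have S: "S \<noteq> {}" "bdd_below S"
    by (auto simp: S_def intro!: bdd_belowI[of _ 0])
  show ?thesis
    unfolding dist_eq
  proof
    assume le: "Inf S \<le> e"
    \<comment> \<open>Every level above \<open>e\<close> dominates a member of \<open>S\<close>.\<close>
    have "approx_within \<eta> A B \<and> approx_within \<eta> B A" if \<eta>: "e < \<eta>" for \<eta>
    proof -
      obtain \<epsilon> where "\<epsilon> \<in> S" "\<epsilon> < \<eta>"
        using cInf_lessD[OF S(1)] le_less_trans[OF le \<eta>] by blast
      then show ?thesis
        by (auto simp: S_def intro: approx_within_mono)
    qed
    then show "approx_within e A B \<and> approx_within e B A"
      using dense_ge CB_D(2)[OF A] CB_D(2)[OF B] by (metis approx_within_iff_infdist)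
  next
    assume within: "approx_within e A B \<and> approx_within e B A"
    then have "0 \<le> e"
      using approx_within_nonneg CB_D(2)[OF A] by blast
    show "Inf S \<le> e"
    proof (rule dense_ge)
      fix \<eta> assume "e < \<eta>"
      then have "\<eta> \<in> S"
        using within \<open>0 \<le> e\<close> by (auto simp: S_def intro: approx_within_mono)
      then show "Inf S \<le> \<eta>"
        using S(2) by (rule cInf_lower)
    qed
  qed
qed

lemma Metric_space_CB: "Metric_space (CB X) (hausdorff_dist X)"
proof
  fix A B :: "'a set"
  show "0 \<le> hausdorff_dist X A B"
  proof (cases "A \<in> CB X \<and> B \<in> CB X")
    case True
    then show ?thesis
      using hausdorff_dist_le_iff[of A X B "hausdorff_dist X A B"] CB_D(2)[of A X]
        approx_within_nonneg by blast
  qed (auto simp: hausdorff_dist_def)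
  show "hausdorff_dist X A B = hausdorff_dist X B A"
    by (simp add: hausdorff_dist_def conj_commute)
next
  fix A B :: "'a set"
  assume A: "A \<in> CB X" and B: "B \<in> CB X"
  \<comment> \<open>Points at distance 0 from a set lie in its closure, hence in the set itself as it is
    closed in \<open>X\<close>.\<close>
  have absorb: "C \<subseteq> D" if "C \<in> CB X" "D \<in> CB X" "approx_within 0 C D" for C D
  proof
    fix x assume "x \<in> C"
    with that have "infdist x D = 0"
      using approx_within_iff_infdist[of D 0 C] CB_D(2)[of D X] infdist_nonneg[of x D] by force
    then have "x \<in> closure D"
      using in_closure_iff_infdist_zero CB_D(2)[OF that(2)] by blast
    moreover have "x \<in> X"
      using \<open>x \<in> C\<close> CB_D(1)[OF that(1)] by blast
    ultimately show "x \<in> D"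
      using Int_closure_CB[OF that(2)] by blast
  qed
  show "hausdorff_dist X A B = 0 \<longleftrightarrow> A = B"
  proof
    assume "hausdorff_dist X A B = 0"
    then have "approx_within 0 A B" "approx_within 0 B A"
      using hausdorff_dist_le_iff[OF A B, of 0] by auto
    then show "A = B"
      using absorb[OF A B] absorb[OF B A] by blast
  next
    assume "A = B"
    moreover have "approx_within 0 A A"
      unfolding approx_within_def by (metis dist_self less_imp_le)
    ultimately have "hausdorff_dist X A B \<le> 0"
      using hausdorff_dist_le_iff[OF A B, of 0] by simp
    moreover have "0 \<le> hausdorff_dist X A B"
      using hausdorff_dist_le_iff[OF A B, of "hausdorff_dist X A B"] CB_D(2)[OF A]
        approx_within_nonneg by blast
    ultimately show "hausdorff_dist X A B = 0" by simp
  qed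
next
  fix A B C :: "'a set"
  assume A: "A \<in> CB X" and B: "B \<in> CB X" and C: "C \<in> CB X"
  have AB: "approx_within (hausdorff_dist X A B) A B" "approx_within (hausdorff_dist X A B) B A"
    using hausdorff_dist_le_iff[OF A B] by auto
  have BC: "approx_within (hausdorff_dist X B C) B C" "approx_within (hausdorff_dist X B C) C B"
    using hausdorff_dist_le_iff[OF B C] by auto
  show "hausdorff_dist X A C \<le> hausdorff_dist X A B + hausdorff_dist X B C"
    using approx_within_trans[OF AB(1) BC(1)] approx_within_trans[OF BC(2) AB(2)]
      hausdorff_dist_le_iff[OF A C] by (simp add: add.commute)
qed

section \<open>Combinations of sets\<close>

definition comb :: "real \<Rightarrow> 'a::real_normed_vector set \<Rightarrow> 'a set \<Rightarrow> 'a set" where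
  "comb t A B = {(1 - t) *\<^sub>R a + t *\<^sub>R b | a b. a \<in> A \<and> b \<in> B}"

lemma combI: "a \<in> A \<Longrightarrow> b \<in> B \<Longrightarrow> (1 - t) *\<^sub>R a + t *\<^sub>R b \<in> comb t A B"
  unfolding comb_def by blast

lemma combE:
  assumes "x \<in> comb t A B"
  obtains a b where "a \<in> A" "b \<in> B" "x = (1 - t) *\<^sub>R a + t *\<^sub>R b"
  using assms unfolding comb_def by blast

lemma comb_eq_image: "comb t A B = (\<lambda>(a, b). (1 - t) *\<^sub>R a + t *\<^sub>R b) ` (A \<times> B)"
  unfolding comb_def by auto

lemma comb_mono: "A \<subseteq> A' \<Longrightarrow> B \<subseteq> B' \<Longrightarrow> comb t A B \<subseteq> comb t A' B'"
  unfolding comb_def by blast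

lemma comb_subset_convex:
  "convex X \<Longrightarrow> A \<subseteq> X \<Longrightarrow> B \<subseteq> X \<Longrightarrow> t \<in> {0..1} \<Longrightarrow> comb t A B \<subseteq> X"
  unfolding comb_def convex_alt by fastforce

lemma comb_self:
  assumes "convex A" "t \<in> {0..1}"
  shows "comb t A A = A"
proof (rule antisym)
  show "A \<subseteq> comb t A A"
  proof
    fix a assume "a \<in> A"
    then have "(1 - t) *\<^sub>R a + t *\<^sub>R a \<in> comb t A A" by (intro combI)
    then show "a \<in> comb t A A" by (simp flip: scaleR_add_left)
  qed
qed (use assms comb_subset_convex[of A A A t] in auto)

lemma comb_commute: "comb t A B = comb (1 - t) B A"
  unfolding comb_def by (auto simp: add.commute)

lemma comb_0: "B \<noteq> {} \<Longrightarrow> comb 0 A B = A"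
  unfolding comb_def by auto

lemma bounded_comb:
  assumes "bounded A" "bounded B"
  shows "bounded (comb t A B)"
proof -
  have "comb t A B = (\<Union>x\<in>(*\<^sub>R) (1 - t) ` A. \<Union>y\<in>(*\<^sub>R) t ` B. {x + y})"
    unfolding comb_def by auto
  then show ?thesis
    using bounded_sums[OF bounded_scaling[OF assms(1), of "1 - t"] bounded_scaling[OF assms(2), of t]]
    by (auto elim!: bounded_subset)
qed

lemma convex_comb:
  assumes "convex A" "convex B"
  shows "convex (comb t A B)"
proof -
  have "linear (\<lambda>(a, b). (1 - t) *\<^sub>R a + t *\<^sub>R b :: 'a)"
    by (intro linearI) (auto simp: algebra_simps)
  then show ?thesis
    unfolding comb_eq_image using assms by (intro convex_linear_image convex_Times)
qed

text \<open>Continuity of the vector operations; it lets inner closures be dropped in nested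
  combinations.\<close>

lemma comb_closure_subset: "comb t (closure A) (closure B) \<subseteq> closure (comb t A B)"
  unfolding comb_eq_image closure_Times[symmetric]
  by (rule continuous_image_closure_subset[of UNIV]) (auto intro!: continuous_intros simp: split_def)

text \<open>Two weights on the same convex set merge into one: this is the law \<open>pA + qA = (p + q)A\<close>.\<close>

lemma convex_merge:
  assumes "convex A" "a \<in> A" "a' \<in> A" "0 \<le> p" "0 \<le> q"
  obtains c where "c \<in> A" "p *\<^sub>R a + q *\<^sub>R a' = (p + q) *\<^sub>R c"
proof (cases "p + q = 0")
  case True
  then have "p = 0" "q = 0" using assms(4,5) by linarith+
  then show ?thesis using that[OF assms(2)] by simp
next
  case False
  let ?c = "(p / (p + q)) *\<^sub>R a + (q / (p + q)) *\<^sub>R a'"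
  have "?c \<in> A"
    using False assms by (intro convexD) (auto simp flip: add_divide_distrib)
  moreover have "p *\<^sub>R a + q *\<^sub>R a' = (p + q) *\<^sub>R ?c"
    using False by (simp add: scaleR_add_right)
  ultimately show ?thesis by (rule that)
qed

text \<open>Consistency before taking closures.  Convexity gives the inclusion from left to right, by
  merging the two points of \<open>A\<close> and the two points of \<open>B\<close>; for the converse the same two points
  serve both inner combinations.\<close>

lemma comb_comb:
  assumes A: "convex A" and B: "convex B"
    and r: "r \<in> {0..1}" and s: "s \<in> {0..1}" and t: "t \<in> {0..1}"
  shows "comb t (comb r A B) (comb s A B) = comb ((1 - t) * r + t * s) A B"
proof (rule antisym; rule subsetI)
  let ?q = "(1 - t) * r + t * s"
  have weight: "(1 - t) * (1 - r) + t * (1 - s) = 1 - ?q"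
    by (simp add: algebra_simps)
  fix x assume "x \<in> comb t (comb r A B) (comb s A B)"
  then obtain a b a' b' where ab: "a \<in> A" "b \<in> B" "a' \<in> A" "b' \<in> B"
    and x: "x = (1 - t) *\<^sub>R ((1 - r) *\<^sub>R a + r *\<^sub>R b) + t *\<^sub>R ((1 - s) *\<^sub>R a' + s *\<^sub>R b')"
    by (elim combE) blast
  obtain c where c: "c \<in> A"
    "((1 - t) * (1 - r)) *\<^sub>R a + (t * (1 - s)) *\<^sub>R a' = (1 - ?q) *\<^sub>R c"
    using convex_merge[OF A ab(1,3), of "(1 - t) * (1 - r)" "t * (1 - s)"] r s t
    unfolding weight by auto
  obtain d where d: "d \<in> B" "((1 - t) * r) *\<^sub>R b + (t * s) *\<^sub>R b' = ?q *\<^sub>R d"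
    using convex_merge[OF B ab(2,4), of "(1 - t) * r" "t * s"] r s t by auto
  have "x = (((1 - t) * (1 - r)) *\<^sub>R a + (t * (1 - s)) *\<^sub>R a')
      + (((1 - t) * r) *\<^sub>R b + (t * s) *\<^sub>R b')"
    unfolding x by (simp add: scaleR_add_right)
  also have "\<dots> = (1 - ?q) *\<^sub>R c + ?q *\<^sub>R d"
    unfolding c(2) d(2) ..
  finally show "x \<in> comb ?q A B"
    using combI[OF c(1) d(1)] by simp
next
  let ?q = "(1 - t) * r + t * s"
  fix x assume "x \<in> comb ?q A B"
  then obtain a b where ab: "a \<in> A" "b \<in> B" and x: "x = (1 - ?q) *\<^sub>R a + ?q *\<^sub>R b"
    by (rule combE)
  have "x = (1 - t) *\<^sub>R ((1 - r) *\<^sub>R a + r *\<^sub>R b) + t *\<^sub>R ((1 - s) *\<^sub>R a + s *\<^sub>R b)"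
    unfolding x by (simp add: algebra_simps)
  then show "x \<in> comb t (comb r A B) (comb s A B)"
    using ab by (auto intro!: combI)
qed

text \<open>The contraction inequality before taking closures: each summand is moved on its own, and
  the same slack \<open>\<delta>\<close> works for both since the weights add up to 1.\<close>

lemma approx_within_comb:
  assumes "approx_within e A C" "approx_within f B D" and t: "t \<in> {0..1}"
  shows "approx_within ((1 - t) * e + t * f) (comb t A B) (comb t C D)"
  unfolding approx_within_def
proof (intro ballI allI impI)
  fix x \<eta> assume "x \<in> comb t A B" and \<eta>: "(1 - t) * e + t * f < \<eta>"
  then obtain a b where ab: "a \<in> A" "b \<in> B" and x: "x = (1 - t) *\<^sub>R a + t *\<^sub>R b"
    by (elim combE)
  define \<delta> where "\<delta> = \<eta> - ((1 - t) * e + t * f)"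
  have "\<delta> > 0" using \<eta> by (simp add: \<delta>_def)
  obtain c where c: "c \<in> C" "dist a c \<le> e + \<delta>"
    using assms(1) ab(1) \<open>\<delta> > 0\<close> unfolding approx_within_def by (metis less_add_same_cancel1)
  obtain d where d: "d \<in> D" "dist b d \<le> f + \<delta>"
    using assms(2) ab(2) \<open>\<delta> > 0\<close> unfolding approx_within_def by (metis less_add_same_cancel1)
  have "dist x ((1 - t) *\<^sub>R c + t *\<^sub>R d)
      \<le> dist ((1 - t) *\<^sub>R a) ((1 - t) *\<^sub>R c) + dist (t *\<^sub>R b) (t *\<^sub>R d)"
    unfolding x by (rule dist_triangle_add)
  also have "\<dots> = (1 - t) * dist a c + t * dist b d"
    using t by (simp add: dist_norm flip: scaleR_diff_right)
  also have "\<dots> \<le> (1 - t) * (e + \<delta>) + t * (f + \<delta>)"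
    using c(2) d(2) t by (intro add_mono mult_left_mono) auto
  also have "\<dots> = \<eta>"
    by (simp add: \<delta>_def algebra_simps)
  finally show "\<exists>y\<in>comb t C D. dist x y \<le> \<eta>"
    using combI[OF c(1) d(1)] by blast
qed

section \<open>The hyperspace bicombing\<close>

lemma hyper_bicombing_eq:
  assumes "convex X" "A \<subseteq> X" "B \<subseteq> X" "t \<in> {0..1}"
  shows "hyper_bicombing X A B t = X \<inter> closure (comb t A B)"
  using comb_subset_convex[OF assms]
  by (simp add: hyper_bicombing_def closure_of_subtopology Int_absorb1 flip: comb_def)

lemma hyper_bicombing_in_CB:
  assumes X: "convex X" and A: "A \<in> CB X" and B: "B \<in> CB X" and t: "t \<in> {0..1}"
  shows "hyper_bicombing X A B t \<in> CB X"
proof -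
  have sub: "comb t A B \<subseteq> hyper_bicombing X A B t"
    using hyper_bicombing_eq[OF X CB_D(1)[OF A] CB_D(1)[OF B] t]
      comb_subset_convex[OF X CB_D(1)[OF A] CB_D(1)[OF B] t] closure_subset[of "comb t A B"] by simp
  have "comb t A B \<noteq> {}"
    using CB_D(2)[OF A] CB_D(2)[OF B] by (simp add: comb_eq_image)
  moreover have "bounded (closure (comb t A B))" "convex (X \<inter> closure (comb t A B))"
    using A B X by (auto intro!: bounded_comb convex_Int convex_closure convex_comb dest: CB_D)
  moreover have "hyper_bicombing X A B t = X \<inter> closure (comb t A B)"
    by (rule hyper_bicombing_eq[OF X CB_D(1)[OF A] CB_D(1)[OF B] t])
  ultimately show ?thesis
    using sub by (auto simp: CB_def intro: bounded_subset closedin_closed_Int)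
qed

lemma hyper_bicombing_contractive:
  assumes X: "convex X" and CB: "A \<in> CB X" "B \<in> CB X" "C \<in> CB X" "D \<in> CB X"
    and t: "t \<in> {0..1}"
  shows "hausdorff_dist X (hyper_bicombing X A B t) (hyper_bicombing X C D t)
    \<le> (1 - t) * hausdorff_dist X A C + t * hausdorff_dist X B D"
proof -
  have step: "approx_within ((1 - t) * hausdorff_dist X A C + t * hausdorff_dist X B D)
      (hyper_bicombing X A' B' t) (hyper_bicombing X C' D' t)"
    if "approx_within (hausdorff_dist X A C) A' C'" "approx_within (hausdorff_dist X B D) B' D'"
      "A' \<in> CB X" "B' \<in> CB X" "C' \<in> CB X" "D' \<in> CB X" for A' B' C' D'
  proof (rule approx_within_closure[OF approx_within_comb[OF that(1,2) t]])
    show "hyper_bicombing X A' B' t \<subseteq> closure (comb t A' B')"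
      using hyper_bicombing_eq[OF X _ _ t] that CB_D(1) by blast
    show "comb t C' D' \<subseteq> hyper_bicombing X C' D' t"
      using hyper_bicombing_eq[OF X CB_D(1) CB_D(1) t] comb_subset_convex[OF X CB_D(1) CB_D(1) t]
        that(5,6) closure_subset[of "comb t C' D'"] by simp
  qed
  have "approx_within (hausdorff_dist X A C) A C \<and> approx_within (hausdorff_dist X A C) C A"
    "approx_within (hausdorff_dist X B D) B D \<and> approx_within (hausdorff_dist X B D) D B"
    using hausdorff_dist_le_iff[OF CB(1,3)] hausdorff_dist_le_iff[OF CB(2,4)] by auto
  then show ?thesis
    using hausdorff_dist_le_iff[OF hyper_bicombing_in_CB[OF X CB(1,2) t]
        hyper_bicombing_in_CB[OF X CB(3,4) t]] step[of A C B D] step[of C A D B] CB by simp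
qed

lemma hyper_bicombing_consistent:
  assumes X: "convex X"
  shows "consistent_bicombing (CB X) (hyper_bicombing X)"
  unfolding consistent_bicombing_def
proof (intro ballI impI)
  fix A B r s t
  assume A: "A \<in> CB X" and B: "B \<in> CB X"
    and r: "r \<in> {0..1::real}" and s: "s \<in> {0..1::real}" and t: "t \<in> {0..1::real}"
  let ?q = "(1 - t) * r + t * s"
  let ?P = "comb r A B" and ?Q = "comb s A B"
  have q: "?q \<in> {0..1}"
    using convexD_alt[of "{0..1::real}" r s t] r s t by simp
  have P: "hyper_bicombing X A B r = X \<inter> closure ?P" "?P \<subseteq> X"
    and Q: "hyper_bicombing X A B s = X \<inter> closure ?Q" "?Q \<subseteq> X"
    using hyper_bicombing_eq[OF X CB_D(1)[OF A] CB_D(1)[OF B]]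
      comb_subset_convex[OF X CB_D(1)[OF A] CB_D(1)[OF B]] r s by simp_all
  \<comment> \<open>Inner closures do not change the outer one.\<close>
  have "closure (comb t (X \<inter> closure ?P) (X \<inter> closure ?Q)) = closure (comb t ?P ?Q)"
  proof (rule antisym)
    have "comb t (X \<inter> closure ?P) (X \<inter> closure ?Q) \<subseteq> closure (comb t ?P ?Q)"
      using comb_mono[of "X \<inter> closure ?P" "closure ?P" "X \<inter> closure ?Q" "closure ?Q" t]
        comb_closure_subset[of t ?P ?Q] by blast
    then show "closure (comb t (X \<inter> closure ?P) (X \<inter> closure ?Q)) \<subseteq> closure (comb t ?P ?Q)"
      by (simp add: closure_minimal)
    show "closure (comb t ?P ?Q) \<subseteq> closure (comb t (X \<inter> closure ?P) (X \<inter> closure ?Q))"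
      using P(2) Q(2) closure_subset by (intro closure_mono comb_mono) auto
  qed
  also have "comb t ?P ?Q = comb ?q A B"
    by (rule comb_comb[OF CB_D(5)[OF A] CB_D(5)[OF B] r s t])
  finally show "hyper_bicombing X (hyper_bicombing X A B r) (hyper_bicombing X A B s) t
      = hyper_bicombing X A B ?q"
    unfolding P(1) Q(1)
    using hyper_bicombing_eq[OF X CB_D(1)[OF A] CB_D(1)[OF B] q]
      hyper_bicombing_eq[OF X _ _ t, of "X \<inter> closure ?P" "X \<inter> closure ?Q"] by simp
qed

lemma hyper_bicombing_reverse: "hyper_bicombing X A B t = hyper_bicombing X B A (1 - t)"
  using comb_commute[of t A B] unfolding hyper_bicombing_def comb_def by simp

theorem proposition4p3:
  fixes X :: "'a::real_normed_vector set"
  assumes "convex X"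
  shows "geodesic_bicombing (CB X) (hausdorff_dist X) (hyper_bicombing X)
    \<and> convex_bicombing (CB X) (hausdorff_dist X) (hyper_bicombing X)
    \<and> consistent_bicombing (CB X) (hyper_bicombing X)
    \<and> reversible_bicombing (CB X) (hyper_bicombing X)"
proof -
  have start: "hyper_bicombing X A B 0 = A" if "A \<in> CB X" "B \<in> CB X" for A B
    using hyper_bicombing_eq[of X A B 0] assms that by (simp add: comb_0 Int_closure_CB CB_D)
  have finish: "hyper_bicombing X A B 1 = B" if "A \<in> CB X" "B \<in> CB X" for A B
    using start[OF that(2,1)] hyper_bicombing_reverse[of X A B 1] by simp
  have idem: "hyper_bicombing X A A t = A" if "A \<in> CB X" "t \<in> {0..1}" for A t
    using hyper_bicombing_eq[of X A A t] assms that by (simp add: comb_self Int_closure_CB CB_D)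
  note result = geodesic_and_convex_if_contractive
    [of "CB X" "hausdorff_dist X" "hyper_bicombing X", OF Metric_space_CB
      hyper_bicombing_in_CB[OF assms] start finish idem hyper_bicombing_consistent[OF assms]
      hyper_bicombing_contractive[OF assms]]
  show ?thesis
    using result hyper_bicombing_consistent[OF assms] hyper_bicombing_reverse
    unfolding reversible_bicombing_def by blast
qed

end
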